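(* Let $G$ be a graph on $n$ vertices, let $g$ be a positive integer, and let $L=L(G,g)$ be the number of cycles of $G$ of length at most $g-1$. Let $q\geq 2$ and $w\geq 0$ be real numbers. Then $$Z^{(2)}_G(q,w)\leq Z_G(q,w)\leq q^{n/g+L}Z^{(2)}_G(q,w).$$
   Context: Graphs are finite. For a graph $G=(V,E)$, $$Z_G(q,w)=\sum_{A\subseteq E}q^{k(A)}w^{|A|},$$ where $k(A)$ is the number of connected components of $(V,A)$. The rank 2 approximation is $$Z^{(2)}_G(q,w)=\sum_{S\subseteq V}(1+w)^{e(S)}(q-1)^{v(G)-|S|}\left(1+\frac{w}{q-1}\right)^{e(G-S)},$$ where $v(G)=|V|$, $e(S)$ is the number of edges of $G$ with both endpoints in $S$, and $e(G-S)$ is the number of edges of $G$ with both endpoints in $V\setminus S$. *)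

theory Defs
  imports Complex_Main
begin

text \<open>Undirected graphs, possibly with parallel edges and loops: \<open>ends G e\<close> is the set of endpoints
  of \<open>e\<close>, a singleton if \<open>e\<close> is a loop. A simple graph is the case where \<open>ends G\<close> is injective on the
  edges and takes only two-element values, for instance \<open>ends G = id\<close>.\<close>

record ('v, 'e) graph =
  verts :: "'v set"
  edges :: "'e set"
  ends :: "'e \<Rightarrow> 'v set"

definition finite_graph :: "('v, 'e) graph \<Rightarrow> bool" where
  "finite_graph G \<longleftrightarrow> finite (verts G) \<and> finite (edges G) \<and>
     (\<forall>e\<in>edges G. ends G e \<subseteq> verts G \<and> card (ends G e) \<in> {1, 2})"

definition adj :: "('v, 'e) graph \<Rightarrow> 'e set \<Rightarrow> 'v rel" where
  "adj G A = {(u, v). \<exists>e\<in>A. ends G e = {u, v}}"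

definition connected_in :: "('v, 'e) graph \<Rightarrow> 'e set \<Rightarrow> 'v rel" where
  "connected_in G A = {(u, v). u \<in> verts G \<and> v \<in> verts G \<and> (u, v) \<in> (adj G A)\<^sup>*}"

definition num_components :: "('v, 'e) graph \<Rightarrow> 'e set \<Rightarrow> nat" where
  "num_components G A = card (verts G // connected_in G A)"

definition edges_within :: "('v, 'e) graph \<Rightarrow> 'v set \<Rightarrow> nat" where
  "edges_within G S = card {e \<in> edges G. ends G e \<subseteq> S}"

definition Z :: "('v, 'e) graph \<Rightarrow> real \<Rightarrow> real \<Rightarrow> real" where
  "Z G q w = (\<Sum>A\<in>Pow (edges G). q ^ num_components G A * w ^ card A)"

definition Z2 :: "('v, 'e) graph \<Rightarrow> real \<Rightarrow> real \<Rightarrow> real" where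
  "Z2 G q w = (\<Sum>S\<in>Pow (verts G).
     (1 + w) ^ edges_within G S * (q - 1) ^ (card (verts G) - card S) *
     (1 + w / (q - 1)) ^ edges_within G (verts G - S))"

text \<open>The closed walk \<open>vs ! 0, es ! 0, vs ! 1, es ! 1, \<dots>, vs ! 0\<close> traverses a cycle. Length 1 is a loop
  and length 2 a pair of parallel edges; in a simple graph distinctness of the edges forces
  length at least 3.\<close>

definition traverses_cycle :: "('v, 'e) graph \<Rightarrow> 'v list \<Rightarrow> 'e list \<Rightarrow> bool" where
  "traverses_cycle G vs es \<longleftrightarrow>
     es \<noteq> [] \<and> length vs = length es \<and> distinct vs \<and> distinct es \<and>
     set vs \<subseteq> verts G \<and> set es \<subseteq> edges G \<and>
     (\<forall>i<length es. ends G (es ! i) = {vs ! i, vs ! (Suc i mod length es)})"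

text \<open>Cycles are counted as subgraphs, that is, without a starting point or a direction. The subgraph
  is determined by its edge set, whose cardinality is the length of the cycle.\<close>

definition cycles :: "('v, 'e) graph \<Rightarrow> 'e set set" where
  "cycles G = {set es | vs es. traverses_cycle G vs es}"

definition num_cycles_upto :: "('v, 'e) graph \<Rightarrow> nat \<Rightarrow> nat" where
  "num_cycles_upto G l = card {C \<in> cycles G. card C \<le> l}"

end

theory Submission
  imports Defs
begin

text \<open>Expanding the two binomial powers in \<open>Z2\<close> and exchanging the sums gives
  \<open>Z2 = (\<Sum>A. w ^ \<bar>A\<bar> * (\<Prod>C. 1 + (q - 1) powr (\<bar>C\<bar> - e(C))))\<close>, where \<open>C\<close> ranges over the components of
  \<open>(V, A)\<close> and \<open>e(C)\<close> is the number of edges of \<open>A\<close> inside \<open>C\<close>: a vertex set without an edge of \<open>A\<close>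
  leaving it is a union of components. A tree component contributes exactly \<open>q\<close>, any other component
  a factor between 1 and 2. Comparing with \<open>q ^ k(A)\<close> term by term gives the lower bound, and the
  upper bound follows because every component that is not a tree contains a cycle, hence either a
  short one (at most \<open>L\<close> such components) or at least \<open>g\<close> vertices (at most \<open>n / g\<close> such components).\<close>

section \<open>Endpoints of edges and connectivity as an equivalence relation\<close>

lemma finite_graph_endsE:
  assumes "finite_graph G" "e \<in> edges G"
  obtains u v where "ends G e = {u, v}" "u \<in> verts G" "v \<in> verts G"
proof -
  from assms have "ends G e \<subseteq> verts G" "card (ends G e) = 1 \<or> card (ends G e) = 2"
    unfolding finite_graph_def by auto
  then show thesis
    using that by (metis card_1_singletonE card_2_iff insert_absorb2 insert_subset)
qed

lemma ends_nonempty: "finite_graph G \<Longrightarrow> e \<in> edges G \<Longrightarrow> ends G e \<noteq> {}"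
  by (auto elim: finite_graph_endsE)

lemma sym_adj: "sym (adj G A)"
  by (auto simp: sym_def adj_def insert_commute)

lemma adj_mono: "A \<subseteq> B \<Longrightarrow> adj G A \<subseteq> adj G B"
  by (auto simp: adj_def)

lemma equiv_connected_in: "equiv (verts G) (connected_in G A)"
proof (rule equivI)
  show "sym (connected_in G A)"
    using sym_rtrancl[OF sym_adj, of G A] by (auto simp: connected_in_def sym_def)
  show "trans (connected_in G A)"
    by (rule transI) (auto simp: connected_in_def intro: rtrancl_trans)
qed (auto simp: connected_in_def refl_on_def)

lemma finite_components: "finite_graph G \<Longrightarrow> finite (verts G // connected_in G A)"
  by (auto intro!: finite_quotient simp: finite_graph_def connected_in_def)

section \<open>Effect of one additional edge on the connectivity classes\<close>

text \<open>Elements outside \<open>U\<close> and \<open>W\<close> keep their class, and all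
  elements of \<open>U\<close> and \<open>W\<close> now share one. The case \<open>U = W\<close> is
  included, so edges inside a class and edges between two classes are treated together.\<close>

lemma quotient_merge:
  assumes "equiv V R" "u \<in> V" "v \<in> V"
  defines "U \<equiv> R `` {u}" and "W \<equiv> R `` {v}"
  shows "V // (R \<union> (U \<union> W) \<times> (U \<union> W)) = insert (U \<union> W) (V // R - {U, W})"
proof -
  let ?R' = "R \<union> (U \<union> W) \<times> (U \<union> W)"
  have 1: "?R' `` {x} = (if x \<in> U \<union> W then U \<union> W else R `` {x})" if "x \<in> V" for x
  proof -
    have "trans R" using assms(1) by (simp add: equiv_def)
    then have "x \<in> U \<Longrightarrow> R `` {x} \<subseteq> U" "x \<in> W \<Longrightarrow> R `` {x} \<subseteq> W"
      unfolding U_def W_def by (blast dest: transD)+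
    then show ?thesis by auto
  qed
  have 2: "R `` {x} \<in> {U, W} \<longleftrightarrow> x \<in> U \<union> W" if "x \<in> V" for x
  proof -
    have "R `` {x} = R `` {y} \<longleftrightarrow> x \<in> R `` {y}" if "y \<in> V" for y
      using eq_equiv_class_iff[OF assms(1) that \<open>x \<in> V\<close>] by auto
    then show ?thesis using assms(2,3) unfolding U_def W_def by simp
  qed
  have "u \<in> U" unfolding U_def by (rule equiv_class_self[OF assms(1,2)])
  show ?thesis
  proof (intro set_eqI iffI)
    fix X assume "X \<in> V // ?R'"
    then obtain x where x: "x \<in> V" "X = ?R' `` {x}" by (rule quotientE)
    show "X \<in> insert (U \<union> W) (V // R - {U, W})"
      using x 1[OF x(1)] 2[OF x(1)] by (auto simp: quotientI)
  next
    fix X assume "X \<in> insert (U \<union> W) (V // R - {U, W})"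
    then consider "X = U \<union> W" | x where "x \<in> V" "X = R `` {x}" "x \<notin> U \<union> W"
      using 2 by (auto elim!: quotientE)
    then have "\<exists>x\<in>V. X = ?R' `` {x}"
      using 1 \<open>u \<in> U\<close> \<open>u \<in> V\<close> by (metis UnI1)
    then show "X \<in> V // ?R'" by (auto simp: quotientI)
  qed
qed

lemma adj_subset_verts:
  assumes "finite_graph G" "A \<subseteq> edges G"
  shows "adj G A \<subseteq> verts G \<times> verts G"
  using assms by (fastforce simp: adj_def finite_graph_def)

lemma connected_in_insert:
  assumes "finite_graph G" "A \<subseteq> edges G" "ends G e = {u, v}" "u \<in> verts G" "v \<in> verts G"
  defines "U \<equiv> connected_in G A `` {u}" and "W \<equiv> connected_in G A `` {v}"
  shows "connected_in G (insert e A) = connected_in G A \<union> (U \<union> W) \<times> (U \<union> W)"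
proof -
  let ?R = "connected_in G A" and ?R' = "connected_in G (insert e A)"
  have eq: "equiv (verts G) ?R" "equiv (verts G) ?R'" by (rule equiv_connected_in)+
  have sub: "?R \<subseteq> ?R'"
    using rtrancl_mono[OF adj_mono[of A "insert e A" G]] by (auto simp: connected_in_def)
  \<comment> \<open>The right-hand side lies in the left: in the larger graph everything in
    \<open>U\<close> or \<open>W\<close> is reachable from \<open>u\<close>, via \<open>e\<close>
    where necessary.\<close>
  have "(u, v) \<in> ?R'" using assms by (auto simp: connected_in_def adj_def)
  with sub have "U \<union> W \<subseteq> ?R' `` {u}"
    using eq(2) unfolding U_def W_def equiv_def by (blast dest: transD)
  then have "(U \<union> W) \<times> (U \<union> W) \<subseteq> ?R'"
    using eq(2) unfolding equiv_def sym_def trans_def by blast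
  moreover have "(x, y) \<in> ?R \<union> (U \<union> W) \<times> (U \<union> W)"
    if "(x, y) \<in> (adj G (insert e A))\<^sup>*" "x \<in> verts G" for x y
    using that
  proof (induction rule: rtrancl_induct)
    case base
    then show ?case by (simp add: connected_in_def)
  next
    case (step y z)
    have xy: "(x, y) \<in> ?R \<union> (U \<union> W) \<times> (U \<union> W)" using step by simp
    show ?case
    proof (cases "(y, z) \<in> adj G A")
      case True
      then have "(y, z) \<in> ?R"
        using adj_subset_verts[OF assms(1,2)] by (auto simp: connected_in_def)
      then show ?thesis using xy eq(1) unfolding U_def W_def equiv_def by (blast dest: transD)
    next
      case False
      \<comment> \<open>The last step runs along \<open>e\<close>, so \<open>y\<close> and
        \<open>z\<close> are \<open>u\<close> and \<open>v\<close> in some order. Since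
        \<open>x\<close> is already related to \<open>y\<close>, both \<open>x\<close> and
        \<open>z\<close> lie in the merged block.\<close>
      with step have "{y, z} = {u, v}" using assms by (auto simp: adj_def)
      moreover have "u \<in> U" "v \<in> W"
        unfolding U_def W_def by (rule equiv_class_self[OF eq(1)], fact)+
      moreover have "x \<in> U" if "(x, u) \<in> ?R"
        using that eq(1) unfolding U_def equiv_def by (auto elim: symE)
      moreover have "x \<in> W" if "(x, v) \<in> ?R"
        using that eq(1) unfolding W_def equiv_def by (auto elim: symE)
      ultimately show ?thesis using xy by (auto simp: doubleton_eq_iff)
    qed
  qed
  then have "?R' \<subseteq> ?R \<union> (U \<union> W) \<times> (U \<union> W)" unfolding connected_in_def[of G "insert e A"] by blast
  ultimately show ?thesis using sub by blast
qed

section \<open>Paths and cycles\<close>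

text \<open>Loop erasure along the walk. Only the vertices are kept distinct here; distinctness of
  the edges will follow from that.\<close>

lemma connected_in_imp_path:
  assumes "(u, v) \<in> (adj G A)\<^sup>*"
  obtains vs es where "length vs = Suc (length es)" "distinct vs" "set es \<subseteq> A"
    "vs ! 0 = u" "vs ! length es = v" "\<forall>i<length es. ends G (es ! i) = {vs ! i, vs ! Suc i}"
proof -
  let ?P = "\<lambda>v vs es. length vs = Suc (length es) \<and> distinct vs \<and> set es \<subseteq> A \<and>
    vs ! 0 = u \<and> vs ! length es = v \<and> (\<forall>i<length es. ends G (es ! i) = {vs ! i, vs ! Suc i})"
  have "\<exists>vs es. ?P v vs es"
    using assms
  proof (induction rule: rtrancl_induct)
    case base
    have "?P u [u] []" by simp
    then show ?case by blast
  next
    case (step y z)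
    then obtain vs es e where P: "?P y vs es" and e: "e \<in> A" "ends G e = {y, z}"
      by (auto simp: adj_def)
    show ?case
    proof (cases "z \<in> set vs")
      case True
      then obtain k where "k < length vs" "vs ! k = z" by (auto simp: in_set_conv_nth)
      \<comment> \<open>The walk returns to a vertex already on the path, so the path is cut back to
        that vertex.\<close>
      then have "?P z (take (Suc k) vs) (take k es)"
        using P by (auto dest: in_set_takeD)
      then show ?thesis by blast
    next
      case False
      then have "?P z (vs @ [z]) (es @ [e])"
        using P e by (auto simp: nth_append less_Suc_eq)
      then show ?thesis by blast
    qed
  qed
  then show thesis using that by blast
qed

text \<open>A path from \<open>u\<close> to \<open>v\<close> in \<open>A\<close> is closed up by
  \<open>e\<close>. Degenerate cases fit the definition of a cycle: an empty path makes
  \<open>e\<close> a loop, a path with one edge gives a parallel pair.\<close>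

lemma path_closes_to_cycle:
  assumes "finite_graph G" "A \<subseteq> edges G" "e \<in> edges G" "e \<notin> A"
    "ends G e = {u, v}" "u \<in> verts G" "(u, v) \<in> (adj G A)\<^sup>*"
  shows "\<exists>vs es. traverses_cycle G vs es \<and> set es \<subseteq> insert e A"
proof -
  obtain vs es where P: "length vs = Suc (length es)" "distinct vs" "set es \<subseteq> A"
    "vs ! 0 = u" "vs ! length es = v" "\<forall>i<length es. ends G (es ! i) = {vs ! i, vs ! Suc i}"
    using connected_in_imp_path[OF assms(7)] by metis
  \<comment> \<open>An edge determines its endpoint pair, and consecutive pairs at different
    positions of a sequence of distinct vertices differ. Hence no edge repeats.\<close>
  have "i = j" if "i < length es" "j < length es" "es ! i = es ! j" for i j
  proof -
    have "{vs ! i, vs ! Suc i} = {vs ! j, vs ! Suc j}" using P(6) that by metis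
    then show ?thesis using P(1,2) that by (auto simp: doubleton_eq_iff nth_eq_iff_index_eq)
  qed
  then have "distinct es" by (auto simp: distinct_conv_nth)
  moreover have "set vs \<subseteq> verts G"
  proof
    fix x assume "x \<in> set vs"
    then obtain i where i: "i < length vs" "x = vs ! i" by (auto simp: in_set_conv_nth)
    show "x \<in> verts G"
    proof (cases i)
      case 0
      then show ?thesis using P i assms by simp
    next
      case (Suc j)
      then have "x \<in> ends G (es ! j)" "es ! j \<in> A" using P i by auto
      then show ?thesis using assms by (auto simp: finite_graph_def)
    qed
  qed
  moreover have "ends G ((es @ [e]) ! i) = {vs ! i, vs ! (Suc i mod length (es @ [e]))}"
    if "i < length (es @ [e])" for i
  proof (cases "i = length es")
    \<comment> \<open>At the last index the modulus wraps around to 0, so the closing edge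
      \<open>e\<close> has to join the end \<open>v\<close> of the path to its start
      \<open>u\<close>.\<close>
    case True
    then show ?thesis using P(4,5) assms(5) by (simp add: insert_commute)
  next
    case False
    then have "i < length es" using that by simp
    then show ?thesis using P(6) by (simp add: nth_append)
  qed
  ultimately have "traverses_cycle G vs (es @ [e])"
    unfolding traverses_cycle_def using P assms by auto
  then show ?thesis using P(3) by (intro exI[of _ vs] exI[of _ "es @ [e]"]) auto
qed

section \<open>Counting components against edges\<close>

lemma num_components_insert:
  assumes "finite_graph G" "A \<subseteq> edges G" "e \<in> edges G" "ends G e = {u, v}"
  shows "num_components G A = num_components G (insert e A) + of_bool ((u, v) \<notin> connected_in G A)"
proof -
  let ?R = "connected_in G A" and ?V = "verts G"
  let ?U = "?R `` {u}" and ?W = "?R `` {v}"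
  have V: "u \<in> ?V" "v \<in> ?V" using assms by (auto simp: finite_graph_def)
  have eq: "equiv ?V ?R" by (rule equiv_connected_in)
  have q: "?V // connected_in G (insert e A) = insert (?U \<union> ?W) (?V // ?R - {?U, ?W})"
    unfolding connected_in_insert[OF assms(1,2,4) V] by (rule quotient_merge[OF eq V])
  have UW: "?U \<in> ?V // ?R" "?W \<in> ?V // ?R" using V by (auto intro: quotientI)
  have fin: "finite (?V // ?R)" by (rule finite_components[OF assms(1)])
  show ?thesis
  proof (cases "(u, v) \<in> ?R")
    case True
    then have "?U = ?W" by (rule equiv_class_eq[OF eq])
    then show ?thesis using True q UW by (auto simp: num_components_def insert_absorb)
  next
    case False
    then have ne: "?U \<noteq> ?W" using eq V by (simp add: eq_equiv_class_iff)
    \<comment> \<open>The merged class is new, so \<open>insert\<close> really adds an element: a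
      class meeting \<open>?U\<close> can only be \<open>?U\<close> itself.\<close>
    have "?U \<union> ?W \<notin> ?V // ?R - {?U, ?W}"
    proof
      assume *: "?U \<union> ?W \<in> ?V // ?R - {?U, ?W}"
      then have "?U \<union> ?W = ?U \<or> (?U \<union> ?W) \<inter> ?U = {}" by (intro quotient_disj[OF eq]) (use UW in auto)
      then show False using * equiv_class_self[OF eq V(1)] by auto
    qed
    then have "card (?V // connected_in G (insert e A)) = Suc (card (?V // ?R) - 2)"
      unfolding q using fin UW ne by (simp add: card_Diff_subset)
    \<comment> \<open>This makes the truncated subtraction of 2 exact.\<close>
    moreover have "card (?V // ?R) \<ge> 2"
      using card_mono[OF fin, of "{?U, ?W}"] UW ne by simp
    ultimately show ?thesis using False by (simp add: num_components_def)
  qed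
qed

lemma num_components_empty: 
  assumes "finite_graph G" shows "num_components G {} = card (verts G)"
proof -
  have "connected_in G {} = Id_on (verts G)" by (auto simp: connected_in_def adj_def)
  then have "verts G // connected_in G {} = (\<lambda>x. {x}) ` verts G" by (auto simp: quotient_def)
  then show ?thesis by (simp add: num_components_def card_image)
qed

text \<open>Without edges equality holds, and each edge lowers the number of components by at most
  one.\<close>

lemma card_verts_le_num_components:
  assumes "finite_graph G" "A \<subseteq> edges G"
  shows "card (verts G) \<le> num_components G A + card A"
proof -
  have "finite A" using assms by (auto simp: finite_graph_def intro: finite_subset)
  then show ?thesis using assms(2)
  proof (induction A rule: finite_induct)
    case empty
    then show ?case using num_components_empty[OF assms(1)] by simp
  next
    case (insert e A)
    then have A: "A \<subseteq> edges G" "e \<in> edges G" by auto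
    obtain u v where "ends G e = {u, v}" using finite_graph_endsE[OF assms(1) A(2)] .
    then have "num_components G A \<le> num_components G (insert e A) + 1"
      using num_components_insert[OF assms(1) A] by simp
    then show ?case using insert.IH[OF A(1)] insert.hyps by simp
  qed
qed

text \<open>The hypothesis says that the cyclomatic number of \<open>A\<close> is positive. An edge
  between two components does not change this number, so it can be removed in the induction; an edge
  within a component closes a cycle.\<close>

lemma ex_cycle:
  assumes "finite_graph G" "A \<subseteq> edges G" "card (verts G) < num_components G A + card A"
  shows "\<exists>vs es. traverses_cycle G vs es \<and> set es \<subseteq> A"
proof -
  have "finite A" using assms by (auto simp: finite_graph_def intro: finite_subset)
  then show ?thesis using assms(2,3)
  proof (induction A rule: finite_induct)
    case empty
    then show ?case using num_components_empty[OF assms(1)] by simp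
  next
    case (insert e A)
    then have A: "A \<subseteq> edges G" "e \<in> edges G" by auto
    obtain u v where uv: "ends G e = {u, v}" "u \<in> verts G"
      using finite_graph_endsE[OF assms(1) A(2)] .
    show ?case
    proof (cases "(u, v) \<in> connected_in G A")
      case True
      then have "(u, v) \<in> (adj G A)\<^sup>*" by (simp add: connected_in_def)
      then show ?thesis using path_closes_to_cycle[OF assms(1) A insert.hyps(2) uv] by simp
    next
      case False
      then have "card (verts G) < num_components G A + card A"
        using num_components_insert[OF assms(1) A uv(1)] insert.hyps insert.prems(2) by simp
      then obtain vs es where "traverses_cycle G vs es" "set es \<subseteq> A" using insert.IH[OF A(1)] by blast
      then show ?thesis by blast
    qed
  qed
qed

section \<open>A single component viewed as a graph\<close>

text \<open>Only edges of \<open>A\<close> are kept, not all edges of \<open>G\<close> inside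
  \<open>C\<close>. For a component \<open>C\<close> of the graph with edge set \<open>A\<close>
  this is that component itself, so the counting lemmas above apply to it.\<close>

definition induced :: "('v, 'e) graph \<Rightarrow> 'e set \<Rightarrow> 'v set \<Rightarrow> ('v, 'e) graph" where
  "induced G A C = G\<lparr>verts := C, edges := {e \<in> A. ends G e \<subseteq> C}\<rparr>"

lemma induced_simps [simp]:
  "verts (induced G A C) = C" "edges (induced G A C) = {e \<in> A. ends G e \<subseteq> C}"
  "ends (induced G A C) = ends G"
  by (simp_all add: induced_def)

lemma adj_induced [simp]: "adj (induced G A C) B = adj G B"
  by (simp add: adj_def)

lemma finite_graph_induced:
  assumes "finite_graph G" "A \<subseteq> edges G" "C \<subseteq> verts G"
  shows "finite_graph (induced G A C)"
  using assms by (auto simp: finite_graph_def intro: finite_subset)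

abbreviation components :: "('v, 'e) graph \<Rightarrow> 'e set \<Rightarrow> 'v set set" where
  "components G A \<equiv> verts G // connected_in G A"

lemma components_disjnt: "pairwise disjnt (components G A)"
  using quotient_disj[OF equiv_connected_in, of _ G A] by (auto simp: pairwise_def disjnt_def)

lemma finite_component:
  assumes "finite_graph G" "C \<in> components G A"
  shows "finite C" "C \<subseteq> verts G"
  using assms in_quotient_imp_subset[OF equiv_connected_in assms(2)]
  by (auto simp: finite_graph_def intro: finite_subset)

lemma edge_in_component:
  assumes "finite_graph G" "A \<subseteq> edges G" "e \<in> A"
  shows "\<exists>C\<in>components G A. ends G e \<subseteq> C"
proof -
  obtain u v where uv: "ends G e = {u, v}" "u \<in> verts G" "v \<in> verts G"
    using finite_graph_endsE[OF assms(1)] assms by blast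
  then have "{u, v} \<subseteq> connected_in G A `` {u}"
    using assms(3) by (auto simp: connected_in_def adj_def)
  then show ?thesis using uv by (auto intro!: bexI[of _ "connected_in G A `` {u}"] quotientI)
qed

lemma edge_component_dichotomy:
  assumes "finite_graph G" "A \<subseteq> edges G" "e \<in> A" "C \<in> components G A"
  shows "ends G e \<subseteq> C \<or> ends G e \<inter> C = {}"
proof -
  obtain D where "D \<in> components G A" "ends G e \<subseteq> D"
    using edge_in_component[OF assms(1-3)] by blast
  then show ?thesis
    using quotient_disj[OF equiv_connected_in assms(4), of D] by blast
qed

text \<open>A walk along \<open>A\<close> that starts in \<open>C\<close> uses only edges inside
  \<open>C\<close>, so discarding the other edges leaves \<open>C\<close> connected.\<close>

lemma num_components_induced:
  assumes "finite_graph G" "A \<subseteq> edges G" "C \<in> components G A"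
  shows "num_components (induced G A C) {e \<in> A. ends G e \<subseteq> C} = 1"
proof -
  let ?B = "{e \<in> A. ends G e \<subseteq> C}"
  have "(x, y) \<in> (adj G ?B)\<^sup>* \<and> y \<in> C" if "(x, y) \<in> (adj G A)\<^sup>*" "x \<in> C" for x y
    using that
  proof (induction rule: rtrancl_induct)
    case (step y z)
    then obtain e where e: "e \<in> A" "ends G e = {y, z}" by (auto simp: adj_def)
    then have "ends G e \<subseteq> C"
      using edge_component_dichotomy[OF assms(1,2) e(1) assms(3)] step by auto
    then have "(y, z) \<in> adj G ?B" "z \<in> C" using e by (auto simp: adj_def)
    then show ?case using step by (auto intro: rtrancl_into_rtrancl)
  qed simp
  moreover have "(x, y) \<in> (adj G A)\<^sup>*" if "x \<in> C" "y \<in> C" for x y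
    using in_quotient_imp_in_rel[OF equiv_connected_in assms(3), of x y] that
    by (simp add: connected_in_def)
  ultimately have "connected_in (induced G A C) ?B = C \<times> C"
    by (auto simp: connected_in_def)
  moreover have "C \<noteq> {}" using in_quotient_imp_non_empty[OF equiv_connected_in assms(3)] .
  then have "C // (C \<times> C) = {C}" by (auto simp: quotient_def)
  ultimately show ?thesis by (simp add: num_components_def)
qed

lemma card_component_le:
  assumes "finite_graph G" "A \<subseteq> edges G" "C \<in> components G A"
  shows "card C \<le> Suc (card {e \<in> A. ends G e \<subseteq> C})"
proof -
  have "finite_graph (induced G A C)"
    using finite_graph_induced[OF assms(1,2)] finite_component(2)[OF assms(1,3)] by blast
  from card_verts_le_num_components[OF this order_refl] show ?thesis
    using num_components_induced[OF assms] by simp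
qed

text \<open>With one component and at least as many edges as vertices, the cyclomatic number is
  positive. A cycle has as many edges as vertices, which bounds its length by \<open>card C\<close>.
  That \<open>D\<close> is nonempty and lies inside \<open>C\<close> later allows \<open>C\<close>
  to be recovered from \<open>D\<close>.\<close>

lemma nontree_component_cycle:
  assumes "finite_graph G" "A \<subseteq> edges G" "C \<in> components G A"
    and "card C \<le> card {e \<in> A. ends G e \<subseteq> C}"
  obtains D where "D \<in> cycles G" "D \<noteq> {}" "card D \<le> card C" "\<And>e. e \<in> D \<Longrightarrow> ends G e \<subseteq> C"
proof -
  let ?H = "induced G A C" and ?B = "{e \<in> A. ends G e \<subseteq> C}"
  have C: "finite C" "C \<subseteq> verts G" using finite_component[OF assms(1,3)] .
  obtain vs es where cyc: "traverses_cycle ?H vs es"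
    using ex_cycle[OF finite_graph_induced[OF assms(1,2) C(2)], of ?B] assms(4)
      num_components_induced[OF assms(1-3)] by auto
  show thesis
  proof
    show "set es \<in> cycles G"
    proof -
      have "traverses_cycle G vs es"
        using cyc C(2) assms(2) unfolding traverses_cycle_def induced_simps by blast
      then show ?thesis by (auto simp: cycles_def)
    qed
    show "set es \<noteq> {}" using cyc by (simp add: traverses_cycle_def)
    have "card (set es) = card (set vs)"
      using cyc by (simp add: traverses_cycle_def distinct_card)
    then show "card (set es) \<le> card C"
      using cyc card_mono[OF C(1), of "set vs"] by (simp add: traverses_cycle_def)
    show "ends G e \<subseteq> C" if "e \<in> set es" for e
      using cyc that by (auto simp: traverses_cycle_def)
  qed
qed

section \<open>The number of components that are not trees\<close>

lemma sum_card_components: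
  assumes "finite_graph G"
  shows "(\<Sum>C\<in>components G A. card C) = card (verts G)"
  using card_Union_disjoint[OF components_disjnt, of G A] finite_component(1)[OF assms]
    Union_quotient[OF equiv_connected_in, of G A] by simp

lemma card_nontree_components:
  assumes "finite_graph G" "A \<subseteq> edges G" "g \<ge> 1"
  shows "real (card {C \<in> components G A. card C \<le> card {e \<in> A. ends G e \<subseteq> C}})
    \<le> real (card (verts G)) / real g + real (num_cycles_upto G (g - 1))"
proof -
  let ?P = "components G A"
  let ?N = "{C \<in> ?P. card C \<le> card {e \<in> A. ends G e \<subseteq> C}}"
  \<comment> \<open>\<open>?big\<close> admits trees as well, because its bound rests on the number
    of vertices alone; cycles are needed only for \<open>?small\<close>.\<close>
  let ?big = "{C \<in> ?P. g \<le> card C}" and ?small = "{C \<in> ?N. card C < g}"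
  let ?L = "{D \<in> cycles G. card D \<le> g - 1}"
  have fin: "finite ?P" by (rule finite_components[OF assms(1)])
  have "\<forall>C\<in>?N. \<exists>D. D \<in> cycles G \<and> D \<noteq> {} \<and> card D \<le> card C \<and> (\<forall>e\<in>D. ends G e \<subseteq> C)"
    using nontree_component_cycle[OF assms(1,2)] by (metis (no_types, lifting) mem_Collect_eq)
  then obtain cyc where cyc: "\<And>C. C \<in> ?N \<Longrightarrow> cyc C \<in> cycles G \<and> cyc C \<noteq> {} \<and>
      card (cyc C) \<le> card C \<and> (\<forall>e\<in>cyc C. ends G e \<subseteq> C)"
    using bchoice[of ?N "\<lambda>C D. D \<in> cycles G \<and> D \<noteq> {} \<and> card D \<le> card C \<and> (\<forall>e\<in>D. ends G e \<subseteq> C)"] by blast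
  have sub: "D \<subseteq> edges G" if "D \<in> cycles G" for D
    using that by (auto simp: cycles_def traverses_cycle_def)
  have "finite ?L"
    by (rule finite_subset[of _ "Pow (edges G)"]) (use sub assms(1) in \<open>auto simp: finite_graph_def\<close>)
  moreover have "cyc ` ?small \<subseteq> ?L"
  proof (rule image_subsetI)
    fix C assume C: "C \<in> ?small"
    then have "cyc C \<in> cycles G" "card (cyc C) \<le> card C" using cyc[of C] by blast+
    \<comment> \<open>Fewer than \<open>g\<close> vertices means a cycle of length at most
      \<open>g - 1\<close>, the threshold in \<open>?L\<close>.\<close>
    moreover have "card C < g" using C by simp
    ultimately show "cyc C \<in> ?L" by simp
  qed
  \<comment> \<open>Components with the same chosen cycle share an edge of it. Its endpoints lie in
    both, and distinct components are disjoint.\<close>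
  moreover have "inj_on cyc ?small"
  proof (rule inj_onI)
    fix C D assume CD: "C \<in> ?small" "D \<in> ?small" "cyc C = cyc D"
    then obtain e where e: "e \<in> cyc C" "e \<in> cyc D" using cyc[of C] by blast
    moreover have "cyc C \<subseteq> edges G" "\<forall>e\<in>cyc C. ends G e \<subseteq> C" "\<forall>e\<in>cyc D. ends G e \<subseteq> D"
      using CD(1,2) cyc[of C] cyc[of D] sub by blast+
    ultimately have "e \<in> edges G" "ends G e \<subseteq> C" "ends G e \<subseteq> D" by blast+
    moreover from this have "ends G e \<noteq> {}" using ends_nonempty[OF assms(1)] by blast
    ultimately show "C = D"
      using quotient_disj[OF equiv_connected_in, of C G A D] CD by blast
  qed
  ultimately have small: "card ?small \<le> num_cycles_upto G (g - 1)"
    unfolding num_cycles_upto_def by (intro card_inj_on_le[of cyc])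
  have "g * card ?big = (\<Sum>C\<in>?big. g)" by simp
  also have "\<dots> \<le> (\<Sum>C\<in>?big. card C)" by (rule sum_mono) simp
  also have "\<dots> \<le> (\<Sum>C\<in>?P. card C)" using fin by (intro sum_mono2) auto
  finally have "g * card ?big \<le> card (verts G)" using sum_card_components[OF assms(1)] by simp
  then have "real g * real (card ?big) \<le> real (card (verts G))"
    by (metis of_nat_le_iff of_nat_mult)
  then have big: "real (card ?big) \<le> real (card (verts G)) / real g"
    using assms(3) by (simp add: field_simps)
  have "card ?N \<le> card (?big \<union> ?small)" using fin by (intro card_mono) auto
  also have "\<dots> \<le> card ?big + card ?small" by (rule card_Un_le)
  finally show ?thesis using small big by linarith
qed

section \<open>Expansion of \<open>Z2\<close> as a sum over edge subsets\<close>

lemma sum_Pow_prod: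
  fixes f :: "'a \<Rightarrow> 'b :: comm_semiring_1"
  assumes "finite A"
  shows "(\<Sum>B\<in>Pow A. \<Prod>x\<in>B. f x) = (\<Prod>x\<in>A. 1 + f x)"
  using prod_add[OF assms, of f "\<lambda>_. 1"] by (simp add: add.commute)

lemma prod_if_power:
  fixes a b :: "'b :: comm_semiring_1"
  assumes "finite A"
  shows "(\<Prod>x\<in>A. if P x then a else 1) = a ^ card {x \<in> A. P x}"
  using assms by (simp add: prod.If_cases Int_def)

text \<open>This is \<open>(q - 1)\<close> to the power \<open>\<bar>C\<bar> - e(C)\<close>, written without the possibly negative exponent.\<close>

definition component_weight :: "('v, 'e) graph \<Rightarrow> real \<Rightarrow> 'e set \<Rightarrow> 'v set \<Rightarrow> real" where
  "component_weight G q A C = (q - 1) ^ card C * (1 / (q - 1)) ^ card {e \<in> A. ends G e \<subseteq> C}"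

text \<open>This identifies the vertex sets that survive in the expansion. A set that no edge of
  \<open>A\<close> leaves is closed under walks along \<open>A\<close>, hence is the union of the
  classes of its elements.\<close>

lemma Union_components_iff:
  assumes "finite_graph G" "A \<subseteq> edges G" "T \<subseteq> verts G"
  shows "T \<in> Union ` Pow (components G A) \<longleftrightarrow> (\<forall>e\<in>A. ends G e \<subseteq> T \<or> ends G e \<subseteq> verts G - T)"
proof
  assume "T \<in> Union ` Pow (components G A)"
  then obtain Q where Q: "Q \<subseteq> components G A" "T = \<Union>Q" by auto
  show "\<forall>e\<in>A. ends G e \<subseteq> T \<or> ends G e \<subseteq> verts G - T"
  proof
    fix e assume "e \<in> A"
    then have "ends G e \<subseteq> verts G" using assms by (auto simp: finite_graph_def)
    moreover have "\<forall>C\<in>Q. ends G e \<subseteq> C \<or> ends G e \<inter> C = {}"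
      using edge_component_dichotomy[OF assms(1,2) \<open>e \<in> A\<close>] Q by blast
    ultimately show "ends G e \<subseteq> T \<or> ends G e \<subseteq> verts G - T" using Q(2) by blast
  qed
next
  assume *: "\<forall>e\<in>A. ends G e \<subseteq> T \<or> ends G e \<subseteq> verts G - T"
  have closed: "y \<in> T" if "(x, y) \<in> (adj G A)\<^sup>*" "x \<in> T" for x y
    using that
  proof (induction rule: rtrancl_induct)
    case (step y z)
    then show ?case using * by (auto simp: adj_def)
  qed simp
  have "T = (\<Union>x\<in>T. connected_in G A `` {x})"
    using assms(3) closed by (auto simp: connected_in_def)
  moreover have "(\<lambda>x. connected_in G A `` {x}) ` T \<subseteq> components G A"
    using assms(3) by (auto intro: quotientI)
  ultimately show "T \<in> Union ` Pow (components G A)" by blast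
qed

text \<open>Components are nonempty and pairwise disjoint, so a family of them can be read off from
  its union. This permits reindexing by families.\<close>

lemma inj_on_Union_components: "inj_on Union (Pow (components G A))"
proof (rule inj_onI)
  have "Q \<subseteq> Q'" if *: "Q \<subseteq> components G A" "Q' \<subseteq> components G A" "\<Union>Q = \<Union>Q'" for Q Q'
  proof
    fix C assume "C \<in> Q"
    then have C: "C \<in> components G A" using * by blast
    then obtain x where "x \<in> C" using in_quotient_imp_non_empty[OF equiv_connected_in] by blast
    then obtain D where "D \<in> Q'" "x \<in> D" using \<open>C \<in> Q\<close> *(3) by blast
    then show "C \<in> Q'"
      using quotient_disj[OF equiv_connected_in C, of D] \<open>x \<in> C\<close> *(2) by blast
  qed
  then show "Q \<in> Pow (components G A) \<Longrightarrow> Q' \<in> Pow (components G A) \<Longrightarrow> \<Union>Q = \<Union>Q' \<Longrightarrow> Q = Q'"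
    for Q Q' by (metis PowD subset_antisym)
qed

text \<open>Both exponents are additive over disjoint components. An edge of \<open>A\<close> inside
  the union meets some component of \<open>Q\<close>, hence lies inside it, and having an endpoint
  it lies in no other.\<close>

lemma prod_component_weight:
  assumes "finite_graph G" "A \<subseteq> edges G" "Q \<subseteq> components G A"
  shows "(\<Prod>C\<in>Q. component_weight G q A C)
    = (q - 1) ^ card (\<Union>Q) * (1 / (q - 1)) ^ card {e \<in> A. ends G e \<subseteq> \<Union>Q}"
proof -
  have finQ: "finite Q" using finite_components[OF assms(1)] assms(3) by (rule rev_finite_subset)
  have finA: "finite A" using assms(1,2) by (auto simp: finite_graph_def intro: finite_subset)
  have disj: "C = D \<or> C \<inter> D = {}" if "C \<in> Q" "D \<in> Q" for C D
    using quotient_disj[OF equiv_connected_in, of C G A D] that assms(3) by blast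
  have "card (\<Union>Q) = (\<Sum>C\<in>Q. card C)"
    using finite_component(1)[OF assms(1)] assms(3)
    by (intro card_Union_disjoint pairwise_subset[OF components_disjnt assms(3)]) auto
  moreover have "{e \<in> A. ends G e \<subseteq> \<Union>Q} = (\<Union>C\<in>Q. {e \<in> A. ends G e \<subseteq> C})"
  proof (intro set_eqI iffI)
    fix e assume e: "e \<in> {e \<in> A. ends G e \<subseteq> \<Union>Q}"
    then have "ends G e \<noteq> {}" using ends_nonempty[OF assms(1)] assms(2) by blast
    then obtain C where "C \<in> Q" "ends G e \<inter> C \<noteq> {}" using e by blast
    then show "e \<in> (\<Union>C\<in>Q. {e \<in> A. ends G e \<subseteq> C})"
      using edge_component_dichotomy[OF assms(1,2), of e C] e assms(3) by blast
  qed auto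
  moreover have "{e \<in> A. ends G e \<subseteq> C} \<inter> {e \<in> A. ends G e \<subseteq> D} = {}"
    if "C \<in> Q" "D \<in> Q" "C \<noteq> D" for C D
  proof -
    have "ends G e \<noteq> {}" if "e \<in> A" for e using ends_nonempty[OF assms(1)] that assms(2) by blast
    then show ?thesis using disj[OF that(1,2)] that(3) by blast
  qed
  then have "card (\<Union>C\<in>Q. {e \<in> A. ends G e \<subseteq> C}) = (\<Sum>C\<in>Q. card {e \<in> A. ends G e \<subseteq> C})"
    using finQ finA by (intro card_UN_disjoint) auto
  ultimately show ?thesis
    by (simp add: component_weight_def prod.distrib power_sum)
qed

lemma Z2_eq_sum_components:
  assumes "finite_graph G" 
  shows "Z2 G q w = (\<Sum>A\<in>Pow (edges G). w ^ card A * (\<Prod>C\<in>components G A. 1 + component_weight G q A C))"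
proof -
  let ?V = "verts G" and ?E = "edges G" and ?r = "1 / (q - 1)"
  have fin: "finite ?V" "finite ?E" using assms by (auto simp: finite_graph_def)
  \<comment> \<open>The weight of choosing \<open>e\<close> in the expansion; it vanishes for an
    edge with one end in \<open>T\<close> and one outside, so that \<open>1 + c T e\<close> is the
    factor contributed by \<open>e\<close> in every case.\<close>
  define c where "c T e = (if ends G e \<subseteq> T then w * ?r else if ends G e \<subseteq> ?V - T then w else 0)" for T e
  \<comment> \<open>Passing to the complement turns the exponent of \<open>q - 1\<close> into
    \<open>card T\<close>.\<close>
  have "Z2 G q w = (\<Sum>T\<in>Pow ?V. (1 + w) ^ edges_within G (?V - T) * (q - 1) ^ card T *
     (1 + w / (q - 1)) ^ edges_within G T)"
    unfolding Z2_def
    by (rule sum.reindex_bij_witness[of _ "\<lambda>T. ?V - T" "\<lambda>T. ?V - T"])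
      (use fin in \<open>auto simp: double_diff card_Diff_subset finite_subset\<close>)
  also have "\<dots> = (\<Sum>T\<in>Pow ?V. \<Sum>A\<in>Pow ?E. (q - 1) ^ card T * (\<Prod>e\<in>A. c T e))"
  proof (rule sum.cong[OF refl])
    fix T
    \<comment> \<open>Endpoint sets are nonempty, so no edge lies both in \<open>T\<close> and in
      its complement, and at most one of the two factors differs from 1.\<close>
    have "(\<Prod>e\<in>?E. 1 + c T e) = (\<Prod>e\<in>?E. (if ends G e \<subseteq> ?V - T then 1 + w else 1) *
        (if ends G e \<subseteq> T then 1 + w / (q - 1) else 1))"
      using ends_nonempty[OF assms] by (intro prod.cong) (auto simp: c_def)
    also have "\<dots> = (1 + w) ^ edges_within G (?V - T) * (1 + w / (q - 1)) ^ edges_within G T"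
      unfolding prod.distrib prod_if_power[OF fin(2)] edges_within_def ..
    finally show "(1 + w) ^ edges_within G (?V - T) * (q - 1) ^ card T *
        (1 + w / (q - 1)) ^ edges_within G T = (\<Sum>A\<in>Pow ?E. (q - 1) ^ card T * (\<Prod>e\<in>A. c T e))"
      by (simp add: sum_Pow_prod[OF fin(2)] flip: sum_distrib_left)
  qed
  also have "\<dots> = (\<Sum>A\<in>Pow ?E. \<Sum>T\<in>Pow ?V. (q - 1) ^ card T * (\<Prod>e\<in>A. c T e))"
    by (rule sum.swap)
  also have "\<dots> = (\<Sum>A\<in>Pow ?E. w ^ card A * (\<Prod>C\<in>components G A. 1 + component_weight G q A C))"
  proof (rule sum.cong[OF refl])
    fix A assume "A \<in> Pow ?E"
    then have A: "A \<subseteq> ?E" and finA: "finite A" using fin by (auto intro: finite_subset)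
    let ?P = "components G A"
    let ?f = "\<lambda>T. (q - 1) ^ card T * (\<Prod>e\<in>A. c T e)"
    have sub: "Union ` Pow ?P \<subseteq> Pow ?V"
      using Union_quotient[OF equiv_connected_in, of G A] by blast
    \<comment> \<open>A set \<open>T\<close> separating the ends of some edge of \<open>A\<close>
      has a zero factor in its product.\<close>
    have "(\<Sum>T\<in>Pow ?V. ?f T) = (\<Sum>T\<in>Union ` Pow ?P. ?f T)"
    proof (rule sum.mono_neutral_right)
      show "\<forall>T\<in>Pow ?V - Union ` Pow ?P. ?f T = 0"
      proof
        fix T assume "T \<in> Pow ?V - Union ` Pow ?P"
        then have "T \<subseteq> ?V" "T \<notin> Union ` Pow ?P" by simp_all
        then have "\<not> (\<forall>e\<in>A. ends G e \<subseteq> T \<or> ends G e \<subseteq> ?V - T)"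
          by (simp only: Union_components_iff[OF assms A] not_False_eq_True)
        then obtain e where "e \<in> A" "\<not> ends G e \<subseteq> T" "\<not> ends G e \<subseteq> ?V - T" by blast
        then have "e \<in> A" "c T e = 0" by (simp_all add: c_def)
        then show "?f T = 0" using prod_zero[OF finA, of "c T"] by auto
      qed
    qed (use fin sub in auto)
    also have "\<dots> = (\<Sum>Q\<in>Pow ?P. ?f (\<Union>Q))"
      by (simp add: sum.reindex[OF inj_on_Union_components])
    also have "\<dots> = (\<Sum>Q\<in>Pow ?P. w ^ card A * (\<Prod>C\<in>Q. component_weight G q A C))"
    proof (rule sum.cong[OF refl])
      fix Q assume Q: "Q \<in> Pow ?P"
      then have "\<forall>e\<in>A. ends G e \<subseteq> \<Union>Q \<or> ends G e \<subseteq> ?V - \<Union>Q"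
        using Union_components_iff[OF assms A, of "\<Union>Q"] sub by blast
      then have "(\<Prod>e\<in>A. c (\<Union>Q) e) = (\<Prod>e\<in>A. w * (if ends G e \<subseteq> \<Union>Q then ?r else 1))"
        by (intro prod.cong) (auto simp: c_def)
      also have "\<dots> = w ^ card A * ?r ^ card {e \<in> A. ends G e \<subseteq> \<Union>Q}"
        unfolding prod.distrib prod_if_power[OF finA] by simp
      finally show "?f (\<Union>Q) = w ^ card A * (\<Prod>C\<in>Q. component_weight G q A C)"
        using prod_component_weight[OF assms A, of Q q] Q by simp
    qed
    \<comment> \<open>The subset expansion is now used backwards: each component is either in
      \<open>Q\<close> or not.\<close>
    also have "\<dots> = w ^ card A * (\<Prod>C\<in>?P. 1 + component_weight G q A C)"
      by (simp add: sum_Pow_prod[OF finite_components[OF assms]] flip: sum_distrib_left)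
    finally show "(\<Sum>T\<in>Pow ?V. ?f T) = w ^ card A * (\<Prod>C\<in>?P. 1 + component_weight G q A C)" .
  qed
  finally show ?thesis .
qed

section \<open>Bounds for the component weights and comparison of the two sums\<close>

lemma component_weight_nonneg: "q \<ge> 1 \<Longrightarrow> component_weight G q A C \<ge> 0"
  by (simp add: component_weight_def)

lemma component_weight_tree:
  assumes "q > 1" "card C = Suc (card {e \<in> A. ends G e \<subseteq> C})"
  shows "component_weight G q A C = q - 1"
  using assms by (simp add: component_weight_def power_one_over)

text \<open>A component is connected, so the exponent of \<open>q - 1\<close> is at most 1. Here
  \<open>q \<ge> 2\<close> enters: with base at least 1, a larger exponent gives a larger
  power.\<close>

lemma component_weight_le:
  assumes "finite_graph G" "A \<subseteq> edges G" "C \<in> components G A" "q \<ge> 2"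
  shows "component_weight G q A C \<le> q - 1"
proof -
  let ?m = "card {e \<in> A. ends G e \<subseteq> C}"
  have "(q - 1) ^ card C \<le> (q - 1) ^ Suc ?m"
    using card_component_le[OF assms(1-3)] assms(4) by (intro power_increasing) auto
  then have "component_weight G q A C \<le> (q - 1) ^ Suc ?m * (1 / (q - 1)) ^ ?m"
    unfolding component_weight_def using assms(4) by (intro mult_right_mono) auto
  also have "\<dots> = q - 1" using assms(4) by (simp add: power_one_over)
  finally show ?thesis .
qed

lemma prod_component_weight_le:
  assumes "finite_graph G" "A \<subseteq> edges G" "q \<ge> 2"
  shows "(\<Prod>C\<in>components G A. 1 + component_weight G q A C) \<le> q ^ num_components G A"
proof -
  have "(\<Prod>C\<in>components G A. 1 + component_weight G q A C) \<le> (\<Prod>C\<in>components G A. q)"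
  proof (rule prod_mono, intro conjI)
    fix C assume "C \<in> components G A"
    then show "1 + component_weight G q A C \<le> q"
      using component_weight_le[OF assms(1,2) _ assms(3)] by force
    show "0 \<le> 1 + component_weight G q A C"
      using component_weight_nonneg[of q G A C] assms(3) by linarith
  qed
  then show ?thesis by (simp add: num_components_def)
qed

text \<open>A tree component has \<open>1 + component_weight\<close> equal to \<open>q\<close>. For
  any other component this is still at least 1, so one extra factor \<open>q\<close> makes up the
  loss; the exponent of the correction is thus the number of components that are not trees.\<close>

lemma power_num_components_le:
  assumes "finite_graph G" "A \<subseteq> edges G" "g \<ge> 1" "q \<ge> 2"
  shows "q ^ num_components G A \<le>
    q powr (real (card (verts G)) / real g + real (num_cycles_upto G (g - 1))) *
    (\<Prod>C\<in>components G A. 1 + component_weight G q A C)"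
proof -
  let ?P = "components G A"
  let ?nontree = "\<lambda>C. card C \<le> card {e \<in> A. ends G e \<subseteq> C}"
  let ?N = "{C \<in> ?P. ?nontree C}"
  have "q ^ num_components G A = (\<Prod>C\<in>?P. q)" by (simp add: num_components_def)
  also have "\<dots> \<le> (\<Prod>C\<in>?P. (if ?nontree C then q else 1) * (1 + component_weight G q A C))"
  proof (rule prod_mono, intro conjI)
    fix C assume C: "C \<in> ?P"
    show "q \<le> (if ?nontree C then q else 1) * (1 + component_weight G q A C)"
    proof (cases "?nontree C")
      case True
      then show ?thesis
        using component_weight_nonneg[of q G A C] assms(4) by (simp add: distrib_left)
    next
      \<comment> \<open>Together with the lower bound on the number of edges of a connected graph,
        this leaves exactly \<open>card C - 1\<close> edges.\<close>
      case False
      then show ?thesis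
        using component_weight_tree[of q C A G] card_component_le[OF assms(1,2) C] assms(4) by simp
    qed
  qed (use assms(4) in simp)
  also have "\<dots> = q ^ card ?N * (\<Prod>C\<in>?P. 1 + component_weight G q A C)"
    unfolding prod.distrib prod_if_power[OF finite_components[OF assms(1)]] ..
  also have "\<dots> \<le> q powr (real (card (verts G)) / real g + real (num_cycles_upto G (g - 1))) *
      (\<Prod>C\<in>?P. 1 + component_weight G q A C)"
  proof (rule mult_right_mono)
    have "q ^ card ?N = q powr real (card ?N)" using assms(4) by (simp add: powr_realpow)
    also have "\<dots> \<le> q powr (real (card (verts G)) / real g + real (num_cycles_upto G (g - 1)))"
      using card_nontree_components[OF assms(1-3)] assms(4) by (intro powr_mono) auto
    finally show "q ^ card ?N \<le> \<dots>" .
    show "0 \<le> (\<Prod>C\<in>?P. 1 + component_weight G q A C)"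
      using component_weight_nonneg[of q G A] assms(4) by (intro prod_nonneg) (simp add: add_nonneg_nonneg)
  qed
  finally show ?thesis .
qed

theorem theorem2p4:
  fixes G :: "('v, 'e) graph" and n g L :: nat and q w :: real
  assumes "finite_graph G" and "card (verts G) = n"
    and "g \<ge> 1" and "L = num_cycles_upto G (g - 1)"
    and "q \<ge> 2" and "w \<ge> 0"
  shows "Z2 G q w \<le> Z G q w \<and>
         Z G q w \<le> q powr (real n / real g + real L) * Z2 G q w"
proof
  let ?F = "\<lambda>A. \<Prod>C\<in>components G A. 1 + component_weight G q A C"
  note Z2 = Z2_eq_sum_components[OF assms(1), of q w]
  show "Z2 G q w \<le> Z G q w"
    unfolding Z2 Z_def
  proof (rule sum_mono)
    fix A assume "A \<in> Pow (edges G)"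
    then have "?F A \<le> q ^ num_components G A" using prod_component_weight_le assms by blast
    then show "w ^ card A * ?F A \<le> q ^ num_components G A * w ^ card A"
      using mult_left_mono[of "?F A" "q ^ num_components G A" "w ^ card A"] assms(6)
      by (simp add: mult.commute)
  qed
  show "Z G q w \<le> q powr (real n / real g + real L) * Z2 G q w"
    unfolding Z2 Z_def sum_distrib_left
  proof (rule sum_mono)
    fix A assume "A \<in> Pow (edges G)"
    then have "q ^ num_components G A \<le> q powr (real n / real g + real L) * ?F A"
      using power_num_components_le[of G A g q] assms by simp
    then have "q ^ num_components G A * w ^ card A \<le> q powr (real n / real g + real L) * ?F A * w ^ card A"
      using assms(6) by (intro mult_right_mono) auto
    then show "q ^ num_components G A * w ^ card A \<le> q powr (real n / real g + real L) * (w ^ card A * ?F A)"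
      by (simp only: mult_ac)
  qed
qed

end
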